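(* The monoid $\mathcal M$ cannot be realized by a von Neumann regular algebra over any uncountable field; that is, if $K$ is an uncountable field, there is no regular $K$-algebra $R$ with $V(R)\cong\mathcal M$.
   Context: For a ring $R$, $V(R)$ is the commutative monoid of equivalence classes $[e]$ of idempotent matrices $e$ over $R$ (where $e\sim f$ iff $e=uv$ and $f=vu$ for some rectangular matrices $u,v$ over $R$), with $[e]+[f]=[\mathrm{diag}(e,f)]$; for unital $R$ this is the monoid of isomorphism classes of finitely generated projective left modules under direct sum. $\mathcal M$ is the commutative monoid presented by the generators $x_0,y_0,z_0,a_1,x_1,y_1,z_1,a_2,x_2,y_2,z_2,\dots$ and the relations $x_0+y_0=x_0+z_0$ and, for all $l\ge 0$, $y_l=y_{l+1}+a_{l+1}$, $z_l=z_{l+1}+a_{l+1}$, $x_l=x_{l+1}+y_{l+1}=x_{l+1}+z_{l+1}$. *)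

theory Defs
  imports
    "Jordan_Normal_Form.Matrix"
    "HOL-Algebra.Group"
    "HOL-Library.Multiset"
    "HOL-Library.Countable_Set"
begin

text \<open>
  Rings are types of class \<open>ring\<close>: associative, not necessarily commutative, and not
  necessarily unital.
\<close>

section \<open>Regular algebras\<close>

locale algebra_over = vector_space scale
  for scale :: "'k::field \<Rightarrow> 'r::ring \<Rightarrow> 'r" +
  assumes scale_mult_left: "scale c x * y = scale c (x * y)"
    and scale_mult_right: "x * scale c y = scale c (x * y)"

definition von_neumann_regular :: "'r::ring itself \<Rightarrow> bool" where
  "von_neumann_regular _ \<longleftrightarrow> (\<forall>x::'r. \<exists>y. x = x * y * x)"


section \<open>The monoid \<open>V(R)\<close>\<close>

text \<open>Size \<open>0\<close> is allowed; the empty matrix represents the neutral element \<open>[0]\<close>.\<close>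

definition idem_mats :: "'r::ring mat set" where
  "idem_mats = {e. square_mat e \<and> e * e = e}"

definition idem_equiv :: "('r::ring mat \<times> 'r mat) set" where
  "idem_equiv = {(e, f). e \<in> idem_mats \<and> f \<in> idem_mats \<and>
     (\<exists>u v. u \<in> carrier_mat (dim_row e) (dim_row f) \<and>
            v \<in> carrier_mat (dim_row f) (dim_row e) \<and>
            e = u * v \<and> f = v * u)}"

definition diag_sum :: "'r::ring mat \<Rightarrow> 'r mat \<Rightarrow> 'r mat" where
  "diag_sum e f =
     four_block_mat e (0\<^sub>m (dim_row e) (dim_col f)) (0\<^sub>m (dim_row f) (dim_col e)) f"

definition V_monoid :: "'r::ring mat set monoid" where
  "V_monoid =
     \<lparr>carrier = idem_mats // idem_equiv,
      mult = (\<lambda>P Q. \<Union>e\<in>P. \<Union>f\<in>Q. idem_equiv `` {diag_sum e f}),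
      one = idem_equiv `` {0\<^sub>m 0 0}\<rparr>"


section \<open>Commutative monoids given by generators and relations\<close>

text \<open>
  The free commutative monoid on \<open>'g\<close> is \<open>'g multiset\<close>; the presented monoid is its
  quotient by the least congruence containing the relations.
\<close>

inductive_set comm_cong :: "('g multiset \<times> 'g multiset) set \<Rightarrow> ('g multiset \<times> 'g multiset) set"
  for Rels where
  base: "(u, v) \<in> Rels \<Longrightarrow> (u, v) \<in> comm_cong Rels"
| refl: "(u, u) \<in> comm_cong Rels"
| sym: "(u, v) \<in> comm_cong Rels \<Longrightarrow> (v, u) \<in> comm_cong Rels"
| trans: "(u, v) \<in> comm_cong Rels \<Longrightarrow> (v, w) \<in> comm_cong Rels \<Longrightarrow> (u, w) \<in> comm_cong Rels"
| add: "(u, v) \<in> comm_cong Rels \<Longrightarrow> (u + w, v + w) \<in> comm_cong Rels"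

definition presented_monoid ::
    "('g multiset \<times> 'g multiset) set \<Rightarrow> 'g multiset set monoid" where
  "presented_monoid Rels =
     \<lparr>carrier = UNIV // comm_cong Rels,
      mult = (\<lambda>P Q. \<Union>u\<in>P. \<Union>v\<in>Q. comm_cong Rels `` {u + v}),
      one = comm_cong Rels `` {{#}}\<rparr>"


section \<open>The monoid \<open>\<M>\<close>\<close>

text \<open>
  \<open>GX l\<close>, \<open>GY l\<close>, \<open>GZ l\<close> stand for \<open>x\<^sub>l\<close>, \<open>y\<^sub>l\<close>, \<open>z\<^sub>l\<close>. There is no \<open>a\<^sub>0\<close>, so the index is
  shifted: \<open>GA l\<close> stands for the generator a of index \<open>l + 1\<close>.
\<close>

datatype gen = GX nat | GY nat | GZ nat | GA nat

definition M_rels :: "(gen multiset \<times> gen multiset) set" where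
  "M_rels =
     {({#GX 0, GY 0#}, {#GX 0, GZ 0#})}
     \<union> (\<Union>l. {({#GY l#}, {#GY (l + 1), GA l#}),
              ({#GZ l#}, {#GZ (l + 1), GA l#}),
              ({#GX l#}, {#GX (l + 1), GY (l + 1)#}),
              ({#GX l#}, {#GX (l + 1), GZ (l + 1)#})})"

definition M_monoid :: "gen multiset set monoid" where
  "M_monoid = presented_monoid M_rels"


section \<open>Well-definedness\<close>

lemma equiv_comm_cong: "equiv UNIV (comm_cong Rels)"
  by (intro equivI refl_onI symI transI)
     (auto intro: comm_cong.refl comm_cong.sym comm_cong.trans)

lemma comm_cong_congruent2:
  "(\<lambda>u v. comm_cong Rels `` {u + v}) respects2 comm_cong Rels"
proof (rule congruent2_commuteI[OF equiv_comm_cong])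
  fix u v w :: "'a multiset"
  assume "(u, v) \<in> comm_cong Rels"
  then have "(u + w, v + w) \<in> comm_cong Rels"
    by (rule comm_cong.add)
  then show "comm_cong Rels `` {w + u} = comm_cong Rels `` {w + v}"
    by (simp add: equiv_class_eq[OF equiv_comm_cong] add.commute)
qed (auto simp: add.commute)

lemma presented_mult:
  "mult (presented_monoid Rels) (comm_cong Rels `` {u}) (comm_cong Rels `` {v})
     = comm_cong Rels `` {u + v}"
  by (simp add: presented_monoid_def
      UN_equiv_class2[OF equiv_comm_cong equiv_comm_cong comm_cong_congruent2])

lemma comm_monoid_presented: "comm_monoid (presented_monoid Rels)"
proof -
  have car: "P \<in> carrier (presented_monoid Rels) \<longleftrightarrow> (\<exists>u. P = comm_cong Rels `` {u})" for P
    by (auto simp: presented_monoid_def quotient_def)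
  have one: "one (presented_monoid Rels) = comm_cong Rels `` {{#}}"
    by (simp add: presented_monoid_def)
  show ?thesis
    by unfold_locales (auto simp: car one presented_mult ac_simps)
qed

lemma idem_mats_carrier: "e \<in> idem_mats \<Longrightarrow> e \<in> carrier_mat (dim_row e) (dim_row e)"
  by (auto simp: idem_mats_def)

lemma idem_mats_idem: "e \<in> idem_mats \<Longrightarrow> e * e = e"
  by (simp add: idem_mats_def)

lemma idem_equivI:
  assumes "e \<in> idem_mats" "f \<in> idem_mats"
    "u \<in> carrier_mat (dim_row e) (dim_row f)" "v \<in> carrier_mat (dim_row f) (dim_row e)"
    "e = u * v" "f = v * u"
  shows "(e, f) \<in> idem_equiv"
  using assms unfolding idem_equiv_def by blast

lemma idem_equivE:
  assumes "(e, f) \<in> idem_equiv"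
  obtains u v where "e \<in> idem_mats" "f \<in> idem_mats"
    "u \<in> carrier_mat (dim_row e) (dim_row f)" "v \<in> carrier_mat (dim_row f) (dim_row e)"
    "e = u * v" "f = v * u"
  using assms unfolding idem_equiv_def by blast

lemma idem_equiv_trans:
  assumes "(e, f) \<in> idem_equiv" "(f, g) \<in> idem_equiv"
  shows "(e, g) \<in> idem_equiv"
proof -
  obtain u v where 1: "e \<in> idem_mats" "f \<in> idem_mats"
    "u \<in> carrier_mat (dim_row e) (dim_row f)" "v \<in> carrier_mat (dim_row f) (dim_row e)"
    "e = u * v" "f = v * u"
    using assms(1) by (rule idem_equivE)
  obtain s t where 2: "g \<in> idem_mats"
    "s \<in> carrier_mat (dim_row f) (dim_row g)" "t \<in> carrier_mat (dim_row g) (dim_row f)"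
    "f = s * t" "g = t * s"
    using assms(2) by (rule idem_equivE)
  define n m k where "n = dim_row e" and "m = dim_row f" and "k = dim_row g"
  have c: "u \<in> carrier_mat n m" "v \<in> carrier_mat m n" "s \<in> carrier_mat m k" "t \<in> carrier_mat k m"
    using 1(3,4) 2(2,3) by (simp_all only: n_def m_def k_def)
  have "(u * s) * (t * v) = u * ((s * t) * v)"
    using c by (simp add: assoc_mult_mat[of _ n m _ k _ n] assoc_mult_mat[of _ m k _ m _ n])
  also have "\<dots> = u * ((v * u) * v)"
    by (simp only: 1(6)[symmetric] 2(4)[symmetric])
  also have "\<dots> = (u * v) * (u * v)"
    using c by (simp add: assoc_mult_mat[of _ n m _ n _ n] assoc_mult_mat[of _ m n _ m _ n])
  finally have e: "e = (u * s) * (t * v)"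
    by (simp only: 1(5)[symmetric] idem_mats_idem[OF 1(1)])
  have "(t * v) * (u * s) = t * ((v * u) * s)"
    using c by (simp add: assoc_mult_mat[of _ k m _ n _ k] assoc_mult_mat[of _ m n _ m _ k])
  also have "\<dots> = t * ((s * t) * s)"
    by (simp only: 1(6)[symmetric] 2(4)[symmetric])
  also have "\<dots> = (t * s) * (t * s)"
    using c by (simp add: assoc_mult_mat[of _ k m _ k _ k] assoc_mult_mat[of _ m k _ m _ k])
  finally have g: "g = (t * v) * (u * s)"
    by (simp only: 2(5)[symmetric] idem_mats_idem[OF 2(1)])
  show ?thesis
    by (rule idem_equivI[OF 1(1) 2(1) _ _ e g]) (use c in \<open>auto simp: n_def k_def\<close>)
qed

lemma equiv_idem_equiv: "equiv idem_mats idem_equiv"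
proof (intro equivI refl_onI symI transI)
  show "idem_equiv \<subseteq> idem_mats \<times> idem_mats"
    by (auto simp: idem_equiv_def)
  show "(e, e) \<in> idem_equiv" if "e \<in> idem_mats" for e :: "'a mat"
    using idem_mats_carrier[OF that] idem_mats_idem[OF that, symmetric]
    by (intro idem_equivI[OF that that])
  show "(f, e) \<in> idem_equiv" if "(e, f) \<in> idem_equiv" for e f :: "'a mat"
    using that by (auto simp: idem_equiv_def)
qed (rule idem_equiv_trans)

lemma mult_diag_blocks:
  assumes "a \<in> carrier_mat n p" "b \<in> carrier_mat m q"
    "c \<in> carrier_mat p n'" "d \<in> carrier_mat q m'"
  shows "four_block_mat a (0\<^sub>m n q) (0\<^sub>m m p) b * four_block_mat c (0\<^sub>m p m') (0\<^sub>m q n') d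
    = four_block_mat (a * c) (0\<^sub>m n m') (0\<^sub>m m n') (b * d)"
  using assms by (simp add: mult_four_block_mat[of _ n p _ q _ m _ _ n' _ m'])

lemma mult_antidiag_blocks:
  assumes "a \<in> carrier_mat n q" "b \<in> carrier_mat m p"
    "c \<in> carrier_mat p m'" "d \<in> carrier_mat q n'"
  shows "four_block_mat (0\<^sub>m n p) a b (0\<^sub>m m q) * four_block_mat (0\<^sub>m p n') c d (0\<^sub>m q m')
    = four_block_mat (a * d) (0\<^sub>m n m') (0\<^sub>m m n') (b * c)"
  using assms by (simp add: mult_four_block_mat[of _ n p _ q _ m _ _ n' _ m'])

lemma diag_sum_idem:
  assumes "e \<in> idem_mats" "f \<in> idem_mats"
  shows "diag_sum e f \<in> idem_mats"
proof -
  note c = idem_mats_carrier[OF assms(1)] idem_mats_carrier[OF assms(2)]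
  have sq: "dim_col e = dim_row e" "dim_col f = dim_row f"
    using assms by (auto simp: idem_mats_def)
  have "diag_sum e f * diag_sum e f = diag_sum e f"
    unfolding diag_sum_def sq mult_diag_blocks[OF c c]
    by (simp only: assms idem_mats_idem)
  then show ?thesis
    by (simp add: idem_mats_def diag_sum_def sq)
qed

lemma diag_sum_cong:
  assumes "(e, e') \<in> idem_equiv" "(f, f') \<in> idem_equiv"
  shows "(diag_sum e f, diag_sum e' f') \<in> idem_equiv"
proof -
  obtain u v where 1: "e \<in> idem_mats" "e' \<in> idem_mats"
    "u \<in> carrier_mat (dim_row e) (dim_row e')" "v \<in> carrier_mat (dim_row e') (dim_row e)"
    "e = u * v" "e' = v * u"
    using assms(1) by (rule idem_equivE)
  obtain s t where 2: "f \<in> idem_mats" "f' \<in> idem_mats"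
    "s \<in> carrier_mat (dim_row f) (dim_row f')" "t \<in> carrier_mat (dim_row f') (dim_row f)"
    "f = s * t" "f' = t * s"
    using assms(2) by (rule idem_equivE)
  have sq: "dim_col e = dim_row e" "dim_col e' = dim_row e'" "dim_col f = dim_row f" "dim_col f' = dim_row f'"
    using 1(1,2) 2(1,2) by (auto simp: idem_mats_def)
  have a: "diag_sum e f =
    four_block_mat u (0\<^sub>m (dim_row e) (dim_row f')) (0\<^sub>m (dim_row f) (dim_row e')) s *
    four_block_mat v (0\<^sub>m (dim_row e') (dim_row f)) (0\<^sub>m (dim_row f') (dim_row e)) t"
    unfolding mult_diag_blocks[OF 1(3) 2(3) 1(4) 2(4)] diag_sum_def sq
    by (simp only: 1(5)[symmetric] 2(5)[symmetric])
  have b: "diag_sum e' f' =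
    four_block_mat v (0\<^sub>m (dim_row e') (dim_row f)) (0\<^sub>m (dim_row f') (dim_row e)) t *
    four_block_mat u (0\<^sub>m (dim_row e) (dim_row f')) (0\<^sub>m (dim_row f) (dim_row e')) s"
    unfolding mult_diag_blocks[OF 1(4) 2(4) 1(3) 2(3)] diag_sum_def sq
    by (simp only: 1(6)[symmetric] 2(6)[symmetric])
  show ?thesis
    by (rule idem_equivI[OF diag_sum_idem[OF 1(1) 2(1)] diag_sum_idem[OF 1(2) 2(2)] _ _ a b])
       (use 1(3,4) 2(3,4) in \<open>auto simp: diag_sum_def\<close>)
qed

lemma diag_sum_commute:
  assumes "e \<in> idem_mats" "f \<in> idem_mats"
  shows "(diag_sum e f, diag_sum f e) \<in> idem_equiv"
proof -
  have sq: "dim_col e = dim_row e" "dim_col f = dim_row f"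
    using assms by (auto simp: idem_mats_def)
  note c = idem_mats_carrier[OF assms(1)] idem_mats_carrier[OF assms(2)]
  have a: "diag_sum e f =
    four_block_mat (0\<^sub>m (dim_row e) (dim_row f)) e f (0\<^sub>m (dim_row f) (dim_row e)) *
    four_block_mat (0\<^sub>m (dim_row f) (dim_row e)) f e (0\<^sub>m (dim_row e) (dim_row f))"
    unfolding mult_antidiag_blocks[OF c(1) c(2) c(2) c(1)] diag_sum_def sq
    by (simp only: assms idem_mats_idem)
  have b: "diag_sum f e =
    four_block_mat (0\<^sub>m (dim_row f) (dim_row e)) f e (0\<^sub>m (dim_row e) (dim_row f)) *
    four_block_mat (0\<^sub>m (dim_row e) (dim_row f)) e f (0\<^sub>m (dim_row f) (dim_row e))"
    unfolding mult_antidiag_blocks[OF c(2) c(1) c(1) c(2)] diag_sum_def sq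
    by (simp only: assms idem_mats_idem)
  show ?thesis
  proof (rule idem_equivI[OF diag_sum_idem[OF assms] diag_sum_idem[OF assms(2,1)] _ _ a b])
    show "four_block_mat (0\<^sub>m (dim_row e) (dim_row f)) e f (0\<^sub>m (dim_row f) (dim_row e))
      \<in> carrier_mat (dim_row (diag_sum e f)) (dim_row (diag_sum f e))"
      by (rule carrier_matI) (simp_all add: diag_sum_def)
    show "four_block_mat (0\<^sub>m (dim_row f) (dim_row e)) f e (0\<^sub>m (dim_row e) (dim_row f))
      \<in> carrier_mat (dim_row (diag_sum f e)) (dim_row (diag_sum e f))"
      by (rule carrier_matI) (simp_all add: diag_sum_def)
  qed
qed

lemma diag_sum_assoc: "diag_sum (diag_sum e f) g = diag_sum e (diag_sum f g)"
  using assoc_four_block_mat[of e f g] by (simp add: diag_sum_def)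

lemma diag_sum_empty: "diag_sum (0\<^sub>m 0 0) e = e"
  by (rule eq_matI) (auto simp: diag_sum_def)

lemma V_mult:
  assumes "e \<in> idem_mats" "f \<in> idem_mats"
  shows "mult V_monoid (idem_equiv `` {e}) (idem_equiv `` {f}) = idem_equiv `` {diag_sum e f}"
proof -
  have "(\<lambda>e f. idem_equiv `` {diag_sum e f}) respects2 idem_equiv"
    by (intro congruent2I' equiv_class_eq[OF equiv_idem_equiv] diag_sum_cong)
  from UN_equiv_class2[OF equiv_idem_equiv equiv_idem_equiv this assms] show ?thesis
    by (simp add: V_monoid_def)
qed

lemma comm_monoid_V: "comm_monoid (V_monoid :: 'r::ring mat set monoid)"
proof -
  have car: "P \<in> carrier V_monoid \<longleftrightarrow> (\<exists>e\<in>idem_mats. P = idem_equiv `` {e})"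
    for P :: "'r mat set"
    by (auto simp: V_monoid_def quotient_def)
  have one: "one (V_monoid :: 'r mat set monoid) = idem_equiv `` {0\<^sub>m 0 0}"
    by (simp add: V_monoid_def)
  have empty: "(0\<^sub>m 0 0 :: 'r mat) \<in> idem_mats"
    by (auto simp: idem_mats_def)
  have comm: "idem_equiv `` {diag_sum e f} = idem_equiv `` {diag_sum f e}"
    if "e \<in> idem_mats" "f \<in> idem_mats" for e f :: "'r mat"
    by (rule equiv_class_eq[OF equiv_idem_equiv diag_sum_commute[OF that]])
  show ?thesis
  proof (rule comm_monoidI)
    fix P Q :: "'r mat set"
    assume "P \<in> carrier V_monoid" "Q \<in> carrier V_monoid"
    then show "P \<otimes>\<^bsub>V_monoid\<^esub> Q = Q \<otimes>\<^bsub>V_monoid\<^esub> P"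
      by (auto simp: car V_mult comm)
  qed (auto simp: car one V_mult empty diag_sum_idem diag_sum_assoc diag_sum_empty)
qed

end

theory Submission
  imports Defs "HOL-Library.Extended_Nat"
begin

text \<open>
  Let \<open>e = p + q = p' + r\<close> be orthogonal decompositions in \<open>V(R) = \<M>\<close> with \<open>[p] = [p'] = x\<^sub>0\<close>,
  \<open>[q] = y\<^sub>0\<close>, \<open>[r] = z\<^sub>0\<close>, and let \<open>s s' = p\<close>, \<open>s' s = p'\<close>. The homomorphisms \<open>\<M> \<rightarrow> \<nat>\<close> that count
  the copies of each \<open>a\<^sub>i\<close> are jointly faithful. Eigenspaces of \<open>s\<close> for distinct scalars are
  independent, so for each \<open>i\<close> only finitely many scalars \<open>l\<close> have an eigenspace in which \<open>a\<^sub>i\<close>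
  occurs; as finite counts can be cancelled, \<open>s - l\<close> is a unit of the corner ring of \<open>e\<close> for all
  but countably many \<open>l\<close>, and likewise for \<open>s'\<close>. Over an uncountable field some \<open>l \<noteq> 0\<close> makes both
  \<open>s - l\<close> and \<open>s' - 1/l\<close> units. Then \<open>s'\<close> is a unit modulo the ideal generated by \<open>r\<close>, so its
  kernel \<open>q\<close> lies in that ideal; in fact \<open>y\<^sub>0 \<le> z\<^sub>0\<close>, which is false in \<open>\<M>\<close>.

  Working with infinite matrices of finite support puts all matrix sizes into a single ring.
\<close>

section \<open>Dimension functions on regular algebras\<close>

text \<open>The trace that an additive map on V(R) leaves on idempotents. The values lie in an
  arbitrary commutative monoid because both \<open>nat\<close>, where one can cancel, and
  \<open>enat\<close>, where infinity absorbs, are needed.\<close>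

locale dim_fun =
  fixes d :: "'a::ring \<Rightarrow> 'm::comm_monoid_add"
  assumes dim_add: "e * e = e \<Longrightarrow> f * f = f \<Longrightarrow> e * f = 0 \<Longrightarrow> f * e = 0 \<Longrightarrow> d (e + f) = d e + d f"
    and dim_cong: "u * v * (u * v) = u * v \<Longrightarrow> v * u * (v * u) = v * u \<Longrightarrow> d (u * v) = d (v * u)"
begin

lemma dim_sub:
  assumes "e * e = e" "f * f = f" "e * f = f" "f * e = f"
  shows "d e = d f + d (e - f)"
  using dim_add[of f "e - f"] assms by (simp add: algebra_simps)

end

text \<open>By \<open>indep\<close> the right ideals of \<open>E\<close> and
  \<open>\<epsilon>\<close> meet only in 0. As \<open>D * z = 0\<close> reads
  \<open>\<epsilon> * z = E * (\<epsilon> * z)\<close>, left multiplication by \<open>D\<close> is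
  injective on the right ideal of \<open>\<epsilon>\<close>. A quasi-inverse \<open>c\<close> then
  makes \<open>\<epsilon>\<close> equivalent to \<open>h = D * c\<close>, and
  \<open>h' = h - h * E\<close> is an equivalent idempotent orthogonal to \<open>E\<close>, so
  \<open>G = E + h'\<close> has the right dimension.\<close>

lemma independent_sum:
  fixes d :: "'a::ring \<Rightarrow> nat" and E \<epsilon> :: 'a
  assumes "dim_fun d" and regular: "von_neumann_regular TYPE('a)"
    and E: "E * E = E" and \<epsilon>: "\<epsilon> * \<epsilon> = \<epsilon>"
    and indep: "\<And>x y. \<epsilon> * x = E * y \<Longrightarrow> \<epsilon> * x = 0"
  obtains G a b where "G * G = G" "d G = d E + d \<epsilon>" "G = E * a + \<epsilon> * b"
proof -
  interpret dim_fun d by fact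
  define D where "D = \<epsilon> - E * \<epsilon>"
  obtain c where c: "D = D * c * D"
    using regular unfolding von_neumann_regular_def by blast
  have ED: "E * D = 0"
    unfolding D_def by (simp add: right_diff_distrib mult.assoc[symmetric] E)
  have D\<epsilon>: "D * \<epsilon> = D"
    unfolding D_def by (simp add: left_diff_distrib mult.assoc \<epsilon>)
  have "D * (c * D - \<epsilon>) = 0"
    using c D\<epsilon> by (simp add: right_diff_distrib mult.assoc)
  then have "\<epsilon> * (c * D - \<epsilon>) = E * (\<epsilon> * (c * D - \<epsilon>))"
    unfolding D_def by (simp add: algebra_simps)
  from indep[OF this] have \<epsilon>cD: "\<epsilon> * c * D = \<epsilon>"
    using \<epsilon> by (simp add: right_diff_distrib mult.assoc)
  define h where "h = D * c"
  define h' where "h' = h - h * E"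
  have hh: "h * h = h"
    unfolding h_def using c by (metis mult.assoc)
  have Eh: "E * h = 0"
    unfolding h_def by (simp add: mult.assoc[symmetric] ED)
  have h'h: "h' * h = h"
    unfolding h'_def by (simp add: left_diff_distrib mult.assoc hh Eh)
  have hh': "h * h' = h'"
    unfolding h'_def by (simp add: right_diff_distrib mult.assoc[symmetric] hh)
  have h'E: "h' * E = 0"
    unfolding h'_def by (simp add: left_diff_distrib mult.assoc E)
  have Eh': "E * h' = 0"
    unfolding h'_def by (simp add: right_diff_distrib mult.assoc[symmetric] Eh)
  have h'h': "h' * h' = h'"
    using h'h hh' by (metis mult.assoc)
  have "d h = d \<epsilon>"
  proof -
    have u: "D * (\<epsilon> * c) = h"
      unfolding h_def by (simp add: mult.assoc[symmetric] D\<epsilon>)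
    show ?thesis
      using dim_cong[of D "\<epsilon> * c"] by (simp only: u \<epsilon>cD hh \<epsilon>)
  qed
  moreover have "d h' = d h"
    using dim_cong[of h h'] by (simp only: hh' h'h hh h'h')
  moreover have "d (E + h') = d E + d h'"
    by (rule dim_add[OF E h'h' Eh' h'E])
  ultimately have dG: "d (E + h') = d E + d \<epsilon>"
    by simp
  \<comment> \<open>Here \<open>h' = D * b\<close>. In the coefficient
    \<open>E - \<epsilon> * b\<close> of \<open>E\<close>, the first \<open>E\<close> stands in for
    a unit element.\<close>
  define b where "b = c - c * E"
  have h'_eq: "h' = \<epsilon> * b - E * (\<epsilon> * b)"
    unfolding h'_def h_def D_def b_def by (simp add: algebra_simps)
  show ?thesis
  proof (rule that[OF _ dG, of "E - \<epsilon> * b" b])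
    show "(E + h') * (E + h') = E + h'"
      by (simp add: distrib_left distrib_right E h'h' Eh' h'E)
    show "E + h' = E * (E - \<epsilon> * b) + \<epsilon> * b"
      unfolding h'_eq by (simp add: right_diff_distrib E)
  qed
qed


text \<open>\<open>e * G = G\<close> compares only right ideals. The idempotent \<open>G * e\<close>
  has the same right ideal as \<open>G\<close>, hence the same dimension, and lies below
  \<open>e\<close> on both sides.\<close>

lemma dim_left_le:
  fixes d :: "'a::ring \<Rightarrow> nat"
  assumes "dim_fun d" and e: "e * e = e" and G: "G * G = G" "e * G = G"
  shows "d G \<le> d e"
proof -
  interpret dim_fun d by fact
  define G' where "G' = G * e"
  have 1: "G * G' = G'" "G' * G = G" "e * G' = G'" "G' * e = G'"
    unfolding G'_def by (simp_all add: mult.assoc e G) (simp_all add: mult.assoc[symmetric] G)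
  have 2: "G' * G' = G'"
    using 1(1,2) unfolding G'_def by (simp add: mult.assoc[symmetric])
  have "d G = d G'"
    using dim_cong[of G' G] by (simp only: 1 2 G)
  also have "\<dots> \<le> d e"
    using dim_sub[of e G'] e 1 2 by simp
  finally show ?thesis .
qed

section \<open>Eigenvalues and units in a corner ring\<close>

context algebra_over
begin

text \<open>Idempotents replace eigenvectors: the right ideal of \<open>e\<close> is the space on
  which \<open>s\<close> acts from the left, \<open>\<epsilon>\<close> generates a part of the
  eigenspace, and only what \<open>d\<close> detects counts.\<close>

definition eigenvalue :: "('r \<Rightarrow> nat) \<Rightarrow> 'r \<Rightarrow> 'r \<Rightarrow> 'k \<Rightarrow> bool" where
  "eigenvalue d e s l \<longleftrightarrow> (\<exists>\<epsilon>. \<epsilon> * \<epsilon> = \<epsilon> \<and> e * \<epsilon> = \<epsilon> \<and> s * \<epsilon> = scale l \<epsilon> \<and> d \<epsilon> \<noteq> 0)"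

text \<open>
  In the induction, \<open>E\<close> projects onto the sum of the eigenspaces treated so far and \<open>P\<close> is
  the product of the corresponding factors \<open>s - l\<close>, which kills \<open>E\<close> but is injective on every
  other eigenspace.
\<close>

lemma card_eigenvalues_le:
  assumes "dim_fun d" and regular: "von_neumann_regular TYPE('r)"
    and e: "e * e = e"
    and F: "finite F" "\<And>l. l \<in> F \<Longrightarrow> eigenvalue d e s l"
  shows "card F \<le> d e"
proof -
  interpret dim_fun d by fact
  have "\<exists>E P. E * E = E \<and> e * E = E \<and> P * E = 0 \<and> card F \<le> d E \<and>
    (\<forall>l x. l \<notin> F \<longrightarrow> e * x = x \<longrightarrow> s * x = scale l x \<longrightarrow> (\<exists>c. c \<noteq> 0 \<and> P * x = scale c x))"
    using F
  proof (induction F)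
    case empty
    \<comment> \<open>No eigenspace is treated yet, so \<open>E = 0\<close>; the empty product is
      \<open>P = e\<close>, which acts as the identity, with factor 1.\<close>
    show ?case
      by (rule exI[of _ 0], rule exI[of _ e]) (auto intro!: exI[of _ 1])
  next
    case (insert m F)
    then obtain E P where E: "E * E = E" "e * E = E" "P * E = 0" "card F \<le> d E"
      and P: "\<And>l x. l \<notin> F \<Longrightarrow> e * x = x \<Longrightarrow> s * x = scale l x \<Longrightarrow> \<exists>c. c \<noteq> 0 \<and> P * x = scale c x"
      by auto
    obtain \<epsilon> where \<epsilon>: "\<epsilon> * \<epsilon> = \<epsilon>" "e * \<epsilon> = \<epsilon>" "s * \<epsilon> = scale m \<epsilon>" "d \<epsilon> \<noteq> 0"
      using insert.prems[of m] unfolding eigenvalue_def by auto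
    obtain c where c: "c \<noteq> 0" "P * \<epsilon> = scale c \<epsilon>"
      using P[OF \<open>m \<notin> F\<close> \<epsilon>(2,3)] by blast
    have indep: "\<epsilon> * x = 0" if "\<epsilon> * x = E * y" for x y
    proof -
      have "P * (\<epsilon> * x) = 0"
        unfolding that by (simp add: mult.assoc[symmetric] E)
      then have "scale c (\<epsilon> * x) = 0"
        by (simp add: mult.assoc[symmetric] c scale_mult_left)
      with c show ?thesis by simp
    qed
    obtain G a b where G: "G * G = G" "d G = d E + d \<epsilon>" "G = E * a + \<epsilon> * b"
      by (rule independent_sum[OF \<open>dim_fun d\<close> regular E(1) \<epsilon>(1) indep])
    define P' where "P' = s * P - scale m P"
    have "P' * E = 0" "P' * \<epsilon> = 0"
      unfolding P'_def
      by (simp_all add: left_diff_distrib mult.assoc E c \<epsilon> scale_mult_left scale_mult_right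
          mult.commute)
    then have "P' * G = 0"
      unfolding G(3) by (simp add: distrib_left mult.assoc[symmetric])
    moreover have "e * G = G"
      unfolding G(3) by (simp add: distrib_left mult.assoc[symmetric] E \<epsilon>)
    moreover have "card (insert m F) \<le> d G"
      using insert.hyps E(4) G(2) \<epsilon>(4) by simp
    moreover have "\<exists>c. c \<noteq> 0 \<and> P' * x = scale c x"
      if l: "l \<notin> insert m F" "e * x = x" "s * x = scale l x" for l x
    proof -
      obtain c where c: "c \<noteq> 0" "P * x = scale c x"
        using P[of l x] l by auto
      have "P' * x = scale ((l - m) * c) x"
        unfolding P'_def
        by (simp add: left_diff_distrib mult.assoc c l scale_mult_left scale_mult_right
            scale_left_diff_distrib right_diff_distrib mult.commute)
      with c l show ?thesis
        by (intro exI[of _ "(l - m) * c"]) auto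
    qed
    ultimately show ?case
      using G(1) by blast
  qed
  then show ?thesis
    using dim_left_le[OF \<open>dim_fun d\<close> e] by (meson le_trans)
qed

lemma finite_eigenvalues:
  assumes "dim_fun d" and "von_neumann_regular TYPE('r)" and "e * e = e"
  shows "finite {l. eigenvalue d e s l}"
proof (rule ccontr)
  assume "infinite {l. eigenvalue d e s l}"
  then obtain F where "finite F" "card F = Suc (d e)" "F \<subseteq> {l. eigenvalue d e s l}"
    using infinite_arbitrarily_large by blast
  with card_eigenvalues_le[OF assms, of F] show False
    by auto
qed

text \<open>Let \<open>t\<close> be a quasi-inverse of \<open>S = s - l e\<close>, compressed to the
  corner. The kernel projection \<open>e - t * S\<close> consists of eigenvectors for
  \<open>l\<close>, so every \<open>d i\<close> vanishes on it. The cokernel projection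
  \<open>e - S * t\<close> has the same dimensions, because \<open>S * t\<close> and
  \<open>t * S\<close> are equivalent and natural numbers cancel. By faithfulness both are
  0.\<close>

lemma unit_if_no_eigenvalue:
  fixes d :: "nat \<Rightarrow> 'r \<Rightarrow> nat"
  assumes dim: "\<And>i. dim_fun (d i)" and regular: "von_neumann_regular TYPE('r)"
    and faithful: "\<And>f. f * f = f \<Longrightarrow> (\<And>i. d i f = 0) \<Longrightarrow> f = 0"
    and e: "e * e = e" "e * s = s" "s * e = s"
    and l: "\<And>i. \<not> eigenvalue (d i) e s l"
  obtains t where "(s - scale l e) * t = e" "t * (s - scale l e) = e" "e * t = t" "t * e = t"
proof -
  define S where "S = s - scale l e"
  have eS: "e * S = S" and Se: "S * e = S"
    unfolding S_def
    by (simp_all add: left_diff_distrib right_diff_distrib e scale_mult_left scale_mult_right)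
  obtain t0 where t0: "S = S * t0 * S"
    using regular unfolding von_neumann_regular_def by blast
  define t where "t = e * t0 * e"
  have STS: "S * t * S = S"
  proof -
    have "S * t * S = (S * e) * t0 * (e * S)"
      unfolding t_def by (simp only: mult.assoc)
    with eS Se t0 show ?thesis
      by simp
  qed
  have et: "e * t = t" and te: "t * e = t"
    unfolding t_def by (simp_all only: mult.assoc e) (simp_all only: mult.assoc[symmetric] e)
  have idem: "S * t * (S * t) = S * t" "t * S * (t * S) = t * S"
    using arg_cong[OF STS, of "\<lambda>x. x * t"] arg_cong[OF STS, of "\<lambda>x. t * x"]
    by (simp_all only: mult.assoc)
  have sub: "e * (S * t) = S * t" "S * t * e = S * t" "e * (t * S) = t * S" "t * S * e = t * S"
    by (simp_all only: mult.assoc te Se) (simp_all only: mult.assoc[symmetric] eS et)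
  have idem': "(e - S * t) * (e - S * t) = e - S * t" "(e - t * S) * (e - t * S) = e - t * S"
    by (simp_all add: left_diff_distrib right_diff_distrib idem sub e)
  have "S * (e - t * S) = 0"
    using STS Se by (simp add: right_diff_distrib mult.assoc)
  moreover have "e * (e - t * S) = e - t * S"
    by (simp add: right_diff_distrib e sub)
  ultimately have "s * (e - t * S) = scale l (e - t * S)"
    unfolding S_def left_diff_distrib scale_mult_left by simp
  then have ker: "d i (e - t * S) = 0" for i
    using l[of i] idem'(2) \<open>e * (e - t * S) = e - t * S\<close> unfolding eigenvalue_def by blast
  have "d i (e - S * t) = d i (e - t * S)" for i
  proof -
    interpret dim_fun "d i" by (rule dim)
    show ?thesis
      using dim_sub[OF e(1) idem(1) sub(1,2)] dim_sub[OF e(1) idem(2) sub(3,4)]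
        dim_cong[OF idem] by linarith
  qed
  with ker have "e - t * S = 0" "e - S * t = 0"
    using faithful[OF idem'(1)] faithful[OF idem'(2)] by simp_all
  then have "S * t = e" "t * S = e"
    by simp_all
  then show ?thesis
    using et te unfolding S_def by (rule that)
qed

text \<open>
  With \<open>U = s - l\<close> and \<open>W = -l (s' - 1/l)\<close> one has \<open>s' U = W - r\<close>; if both are units,
  then \<open>s' q = 0\<close> gives \<open>q = U W\<^sup>-\<^sup>1 r U\<^sup>-\<^sup>1 q\<close>.
\<close>

lemma complement_subequivalent:
  fixes d :: "nat \<Rightarrow> 'r \<Rightarrow> nat" and p q p' r s s' :: 'r
  assumes dim: "\<And>i. dim_fun (d i)" and regular: "von_neumann_regular TYPE('r)"
    and faithful: "\<And>f. f * f = f \<Longrightarrow> (\<And>i. d i f = 0) \<Longrightarrow> f = 0"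
    and uncountable: "uncountable (UNIV :: 'k set)"
    and p: "p * p = p" and q: "q * q = q" "p * q = 0" "q * p = 0"
    and p': "p' * p' = p'" and r: "r * r = r" "p' * r = 0" "r * p' = 0"
    and sum: "p + q = p' + r"
    and equiv: "s * s' = p" "s' * s = p'"
  obtains a b where "q = a * b" "r * b = b" "a * r = a" "b * q = b"
proof -
  define e where "e = p + q"
  \<comment> \<open>Compression by \<open>p\<close> and \<open>p'\<close> puts both maps into the
    corner ring of \<open>e\<close>, keeps \<open>\<sigma>' * \<sigma> = p'\<close> and makes
    \<open>\<sigma>'\<close> kill \<open>q\<close>.\<close>
  define \<sigma> where "\<sigma> = p * s * p'"
  define \<sigma>' where "\<sigma>' = p' * s' * p"
  have e: "e * e = e" "e * p = p" "p * e = p" "e * q = q" "q * e = q"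
    unfolding e_def by (simp_all add: distrib_left distrib_right p q)
  have e': "e * p' = p'" "p' * e = p'" "e * r = r" "r * e = r"
    unfolding e_def sum by (simp_all add: distrib_left distrib_right p' r)
  have \<sigma>: "\<sigma>' * \<sigma> = p'" "e * \<sigma> = \<sigma>" "\<sigma> * e = \<sigma>" "e * \<sigma>' = \<sigma>'" "\<sigma>' * e = \<sigma>'"
  proof -
    have "\<sigma>' * \<sigma> = p' * (s' * (p * p) * s) * p'"
      unfolding \<sigma>_def \<sigma>'_def by (simp only: mult.assoc)
    also have "s' * (p * p) * s = (s' * s) * (s' * s)"
      by (simp only: p, simp only: equiv(1)[symmetric] mult.assoc)
    finally show "\<sigma>' * \<sigma> = p'"
      by (simp only: equiv p')
    show "e * \<sigma> = \<sigma>" "e * \<sigma>' = \<sigma>'"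
      unfolding \<sigma>_def \<sigma>'_def by (simp_all only: mult.assoc[symmetric] e e')
    show "\<sigma> * e = \<sigma>" "\<sigma>' * e = \<sigma>'"
      unfolding \<sigma>_def \<sigma>'_def by (simp_all only: mult.assoc e e')
  qed
  have \<sigma>'q: "\<sigma>' * q = 0"
    unfolding \<sigma>'_def by (simp add: mult.assoc q)
  \<comment> \<open>The scalars to avoid: eigenvalues of \<open>\<sigma>\<close>, inverses of
    eigenvalues of \<open>\<sigma>'\<close>, and 0. Each index \<open>i\<close> contributes only
    finitely many.\<close>
  let ?A = "\<Union>i. {l. eigenvalue (d i) e \<sigma> l}" and ?B = "\<Union>i. {l. eigenvalue (d i) e \<sigma>' l}"
  have "countable (?A \<union> inverse ` ?B \<union> {0})"
    using finite_eigenvalues[OF dim regular e(1)]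
    by (intro countable_Un countable_image countable_UN) (simp_all add: countable_finite)
  then obtain l where l: "l \<notin> ?A" "l \<notin> inverse ` ?B" "l \<noteq> 0"
  proof -
    assume *: "countable (?A \<union> inverse ` ?B \<union> {0})"
    have "?A \<union> inverse ` ?B \<union> {0} \<noteq> UNIV"
      using * uncountable by metis
    then show ?thesis
      using that by blast
  qed
  have l': "inverse l \<notin> ?B"
    using l(2) imageI[of "inverse l" ?B inverse] by auto
  define U where "U = \<sigma> - scale l e"
  \<comment> \<open>Up to the factor \<open>- l\<close> this is the \<open>W\<close> of the remark
    above.\<close>
  define V where "V = \<sigma>' - scale (inverse l) e"
  obtain U' where U': "U * U' = e" "U' * U = e" "e * U' = U'" "U' * e = U'"
    using l(1) unfolding U_def
    by (auto intro: unit_if_no_eigenvalue[where l = l, OF dim regular faithful e(1) \<sigma>(2,3)])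
  obtain V' where V': "V * V' = e" "V' * V = e" "e * V' = V'" "V' * e = V'"
    using l' unfolding V_def
    by (auto intro: unit_if_no_eigenvalue[where l = "inverse l", OF dim regular faithful e(1) \<sigma>(4,5)])
  have eV: "e * V = V"
    unfolding V_def by (simp add: right_diff_distrib \<sigma> e scale_mult_right)
  have "\<sigma>' * U = e - r - scale l \<sigma>'"
    unfolding U_def right_diff_distrib scale_mult_right \<sigma> unfolding e_def sum by simp
  also have "\<dots> = scale (- l) V - r"
    unfolding V_def using l(3) by (simp add: scale_right_diff_distrib)
  finally have "V' * (\<sigma>' * U) = scale (- l) e - V' * r"
    by (simp add: right_diff_distrib scale_mult_right V')
  \<comment> \<open>On \<open>U' * q\<close> the left side collapses to
    \<open>V' * \<sigma>' * q = 0\<close>, which expresses \<open>U' * q\<close> through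
    \<open>r\<close>.\<close>
  then have "V' * (\<sigma>' * U) * (U' * q) = scale (- l) (U' * q) - V' * r * U' * q"
    using U' by (simp add: left_diff_distrib scale_mult_left mult.assoc[symmetric])
  moreover have "V' * (\<sigma>' * U) * (U' * q) = V' * \<sigma>' * (U * U') * q"
    by (simp only: mult.assoc)
  then have "V' * (\<sigma>' * U) * (U' * q) = 0"
    unfolding U' by (simp add: mult.assoc e \<sigma>'q)
  ultimately have "scale (- l) (U' * q) = V' * r * U' * q"
    by simp
  then have "scale (- inverse l) (V' * r * U' * q) = scale (- inverse l) (scale (- l) (U' * q))"
    by simp
  also have "\<dots> = U' * q"
    using l(3) by simp
  finally have U'q: "U' * q = scale (- inverse l) (V' * r * U' * q)"
    by simp
  have rr: "r * (r * x) = r * x" for x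
    by (simp add: mult.assoc[symmetric] r)
  \<comment> \<open>As \<open>r\<close> is idempotent, both factors can keep a copy of it.\<close>
  define a where "a = scale (- inverse l) (U * V' * r)"
  define b where "b = r * U' * q"
  have "q = U * (U' * q)"
    using U' e by (simp add: mult.assoc[symmetric])
  also have "\<dots> = a * b"
    unfolding a_def b_def
    by (subst U'q) (simp add: scale_mult_left scale_mult_right mult.assoc rr)
  finally have "q = a * b" .
  moreover have "r * b = b" "a * r = a" "b * q = b"
    unfolding a_def b_def by (simp_all add: scale_mult_left mult.assoc rr r q)
  ultimately show ?thesis
    by (rule that)
qed

end

section \<open>Finitary matrices\<close>

typedef (overloaded) 'a finmat =
  "{f :: nat \<Rightarrow> nat \<Rightarrow> 'a::zero. \<exists>n. \<forall>i j. n \<le> i \<or> n \<le> j \<longrightarrow> f i j = 0}"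
  morphisms entry Abs_finmat
  by (rule exI[of _ "\<lambda>i j. 0"]) simp

setup_lifting type_definition_finmat

definition supp_within :: "nat \<Rightarrow> 'a::zero finmat \<Rightarrow> bool" where
  "supp_within n a \<longleftrightarrow> (\<forall>i j. n \<le> i \<or> n \<le> j \<longrightarrow> entry a i j = 0)"

lemma supp_within_entry: "supp_within n a \<Longrightarrow> n \<le> i \<or> n \<le> j \<Longrightarrow> entry a i j = 0"
  by (auto simp: supp_within_def)

lemma supp_within_exists: "\<exists>n. supp_within n a"
  using entry[of a] by (auto simp: supp_within_def)

lemma supp_within_mono: "supp_within n a \<Longrightarrow> n \<le> m \<Longrightarrow> supp_within m a"
  by (auto simp: supp_within_def)

lemma supp_within_common: "finite A \<Longrightarrow> \<exists>n. \<forall>a\<in>A. supp_within n a"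
proof (induction rule: finite_induct)
  case (insert a A)
  then obtain n m where "\<forall>a\<in>A. supp_within n a" "supp_within m a"
    using supp_within_exists by blast
  then show ?case
    by (intro exI[of _ "max n m"]) (auto intro: supp_within_mono)
qed simp

lemma finmat_eqI: "(\<And>i j. entry a i j = entry b i j) \<Longrightarrow> a = b"
  by transfer auto

lift_definition single :: "nat \<Rightarrow> nat \<Rightarrow> 'a \<Rightarrow> 'a::zero finmat" is
  "\<lambda>i j x k l. if k = i \<and> l = j then x else 0"
  by (rule_tac x = "Suc (max nat1 nat2)" in exI) auto

text \<open>The case distinction keeps the support finite for every \<open>h\<close>, even if
  \<open>h 0\<close> is not 0.\<close>

lift_definition map_entries :: "('a \<Rightarrow> 'a) \<Rightarrow> 'a::zero finmat \<Rightarrow> 'a finmat" is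
  "\<lambda>h f i j. if f i j = 0 then 0 else h (f i j)"
  by fastforce

instantiation finmat :: (ring) ring
begin

lift_definition zero_finmat :: "'a finmat" is "\<lambda>i j. 0"
  by simp

lift_definition plus_finmat :: "'a finmat \<Rightarrow> 'a finmat \<Rightarrow> 'a finmat" is
  "\<lambda>f g i j. f i j + g i j"
proof -
  fix f g :: "nat \<Rightarrow> nat \<Rightarrow> 'a"
  assume "\<exists>n. \<forall>i j. n \<le> i \<or> n \<le> j \<longrightarrow> f i j = 0" "\<exists>n. \<forall>i j. n \<le> i \<or> n \<le> j \<longrightarrow> g i j = 0"
  then obtain n m where "\<forall>i j. n \<le> i \<or> n \<le> j \<longrightarrow> f i j = 0" "\<forall>i j. m \<le> i \<or> m \<le> j \<longrightarrow> g i j = 0"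
    by blast
  then show "\<exists>n. \<forall>i j. n \<le> i \<or> n \<le> j \<longrightarrow> f i j + g i j = 0"
    by (intro exI[of _ "max n m"]) auto
qed

lift_definition uminus_finmat :: "'a finmat \<Rightarrow> 'a finmat" is "\<lambda>f i j. - f i j"
  by simp

definition minus_finmat :: "'a finmat \<Rightarrow> 'a finmat \<Rightarrow> 'a finmat" where
  "minus_finmat a b = a + - b"

lift_definition times_finmat :: "'a finmat \<Rightarrow> 'a finmat \<Rightarrow> 'a finmat" is
  "\<lambda>f g i j. \<Sum>k | f i k \<noteq> 0. f i k * g k j"
proof -
  fix f g :: "nat \<Rightarrow> nat \<Rightarrow> 'a"
  assume "\<exists>n. \<forall>i j. n \<le> i \<or> n \<le> j \<longrightarrow> f i j = 0" "\<exists>n. \<forall>i j. n \<le> i \<or> n \<le> j \<longrightarrow> g i j = 0"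
  then obtain n m where "\<forall>i j. n \<le> i \<or> n \<le> j \<longrightarrow> f i j = 0" "\<forall>i j. m \<le> i \<or> m \<le> j \<longrightarrow> g i j = 0"
    by blast
  then show "\<exists>n. \<forall>i j. n \<le> i \<or> n \<le> j \<longrightarrow> (\<Sum>k | f i k \<noteq> 0. f i k * g k j) = 0"
    by (intro exI[of _ "max n m"]) auto
qed

text \<open>The product sums over the nonzero entries of a row, since a finitary matrix carries no
  chosen bound. Any bound gives the same sum over a fixed range, where sums can be
  exchanged.\<close>

lemma entry_mult:
  assumes "supp_within n a"
  shows "entry (a * b) i j = (\<Sum>k<n. entry a i k * entry b k j)"
proof -
  have "{k. entry a i k \<noteq> 0} \<subseteq> {..<n}"
    using assms by (auto simp: supp_within_def not_le[symmetric])
  then show ?thesis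
    unfolding times_finmat.rep_eq by (intro sum.mono_neutral_left) auto
qed

instance
proof
  fix a b c :: "'a finmat"
  obtain n where n: "supp_within n a" "supp_within n b" "supp_within n c"
    "supp_within n (a * b)" "supp_within n (a + b)"
    using supp_within_common[of "{a, b, c, a * b, a + b}"] by auto
  show "a * b * c = a * (b * c)"
  proof (rule finmat_eqI)
    fix i j
    have "entry (a * b * c) i j = (\<Sum>k<n. (\<Sum>l<n. entry a i l * entry b l k) * entry c k j)"
      by (simp add: entry_mult[of n] n)
    also have "\<dots> = (\<Sum>l<n. \<Sum>k<n. entry a i l * entry b l k * entry c k j)"
      unfolding sum_distrib_right by (rule sum.swap)
    also have "\<dots> = entry (a * (b * c)) i j"
      by (simp add: entry_mult[of n] n sum_distrib_left mult.assoc)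
    finally show "entry (a * b * c) i j = entry (a * (b * c)) i j" .
  qed
  show "(a + b) * c = a * c + b * c"
    by (rule finmat_eqI)
       (simp add: entry_mult[of n] n plus_finmat.rep_eq distrib_right sum.distrib)
  show "a * (b + c) = a * b + a * c"
    by (rule finmat_eqI)
       (simp add: entry_mult[of n] n plus_finmat.rep_eq distrib_left sum.distrib)
  show "a + b + c = a + (b + c)" "a + b = b + a" "0 + a = a" "- a + a = 0"
    by (rule finmat_eqI;
        simp add: plus_finmat.rep_eq uminus_finmat.rep_eq zero_finmat.rep_eq ac_simps)+
  show "a - b = a + - b"
    by (rule minus_finmat_def)
qed

end

lemma entry_minus: "entry (a - b) i j = entry a i j - entry (b :: 'a::ring finmat) i j"
  by (simp only: minus_finmat_def plus_finmat.rep_eq uminus_finmat.rep_eq) simp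

section \<open>Scalars and regularity for finitary matrices\<close>

lemma algebra_over_finmat:
  fixes scale :: "'k::field \<Rightarrow> 'r::ring \<Rightarrow> 'r"
  assumes "algebra_over scale"
  shows "algebra_over (\<lambda>c. map_entries (scale c))"
proof -
  interpret algebra_over scale by fact
  have e: "entry (map_entries (scale c) a) i j = scale c (entry a i j)" for c a i j
    by (simp add: map_entries.rep_eq)
  show ?thesis
  proof
    fix c c' and a b :: "'r finmat"
    obtain n where n: "supp_within n a" "supp_within n (map_entries (scale c) a)"
      using supp_within_common[of "{a, map_entries (scale c) a}"] by auto
    show "map_entries (scale c) a * b = map_entries (scale c) (a * b)"
      "a * map_entries (scale c) b = map_entries (scale c) (a * b)"
      by (rule finmat_eqI; simp add: entry_mult[of n] n e scale_sum_right scale_mult_left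
          scale_mult_right)+
  qed (rule finmat_eqI; simp add: e plus_finmat.rep_eq scale_left_distrib scale_right_distrib)+
qed

text \<open>The witness is \<open>y + (1 - y * x) * c * (1 - x * y)\<close>, multiplied out because
  the ring need not have a unit.\<close>

lemma regular_reduce:
  fixes x y :: "'a::ring"
  assumes "\<exists>c. x - x * y * x = (x - x * y * x) * c * (x - x * y * x)"
  shows "\<exists>c. x = x * c * x"
proof -
  obtain c where c: "x - x * y * x = (x - x * y * x) * c * (x - x * y * x)"
    using assms by blast
  have "x = x * y * x + (x - x * y * x)"
    by simp
  also have "\<dots> = x * (y + c - y * x * c - c * x * y + y * x * c * x * y) * x"
    by (subst c) (simp add: algebra_simps)
  finally show ?thesis by blast
qed

text \<open>
  McCoy's elimination: with \<open>y\<close> a quasi-inverse of the entry of \<open>b\<close> at \<open>(m, k)\<close>, subtracting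
  \<open>b * single k m y * b\<close> clears that entry and keeps the entries of row \<open>m\<close> and the rows
  that are already zero.
\<close>

lemma von_neumann_regular_finmat:
  assumes regular: "von_neumann_regular TYPE('a::ring)"
  shows "von_neumann_regular TYPE('a finmat)"
proof -
  \<comment> \<open>Outer induction, on the number of rows below \<open>n\<close> that are not yet
    known to be zero.\<close>
  have *: "\<exists>c. a = a * c * a"
    if "supp_within n a" "\<And>i j. i < m \<Longrightarrow> entry a i j = 0" for a :: "'a finmat" and n m
    using that
  proof (induction "n - m" arbitrary: m a)
    case 0
    then have "entry a i j = 0" for i j
      by (cases "i < m") (auto intro: supp_within_entry)
    then have "a = 0"
      by (intro finmat_eqI) (simp add: zero_finmat.rep_eq)
    then show ?case by simp
  next
    case (Suc d)
    \<comment> \<open>Inner induction: row \<open>m\<close> is cleared from left to right. Once it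
      is zero, the outer hypothesis applies to \<open>Suc m\<close>.\<close>
    have **: "\<exists>c. b = b * c * b"
      if "supp_within n b" "\<And>i j. i < m \<Longrightarrow> entry b i j = 0" "\<And>j. j < k \<Longrightarrow> entry b m j = 0"
      for b :: "'a finmat" and k
      using that
    proof (induction "n - k" arbitrary: k b)
      case 0
      then have "entry b m j = 0" for j
        by (cases "j < k") (auto intro: supp_within_entry)
      with 0 have "entry b i j = 0" if "i < Suc m" for i j
        using that by (auto simp: less_Suc_eq)
      with 0 Suc.hyps show ?case
        by (intro Suc.hyps(1)[of "Suc m"]) auto
    next
      case (Suc e)
      obtain y where y: "entry b m k = entry b m k * y * entry b m k"
        using regular unfolding von_neumann_regular_def by blast
      define b' where "b' = b - b * single k m y * b"
      have k: "k < n"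
        using Suc.hyps by simp
      have m: "m < n"
        using \<open>Suc d = n - m\<close> by simp
      have single: "entry (b * single k m y) i j = (if j = m then entry b i k * y else 0)" for i j
      proof -
        have "entry b i l * entry (single k m y) l j =
            (if l = k then if j = m then entry b i k * y else 0 else 0)" for l
          by (simp add: single.rep_eq)
        then show ?thesis
          using k by (simp add: entry_mult[OF Suc.prems(1)])
      qed
      have supp: "supp_within n (b * single k m y)"
        using Suc.prems(1) m by (auto simp: supp_within_def single)
      have b': "entry b' i j = entry b i j - entry b i k * y * entry b m j" for i j
      proof -
        have "(if l = m then entry b i k * y else 0) * entry b l j =
            (if l = m then entry b i k * y * entry b m j else 0)" for l
          by simp
        then show ?thesis
          using m unfolding b'_def by (simp add: entry_minus entry_mult[OF supp] single)
      qed
      have "\<exists>c. b' = b' * c * b'"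
      proof (rule Suc.hyps(1)[of "Suc k"])
        show "e = n - Suc k"
          using Suc.hyps by simp
        show "supp_within n b'"
          using Suc.prems(1) by (auto simp: supp_within_def b')
        show "entry b' i j = 0" if "i < m" for i j
          using Suc.prems(2) that by (simp add: b')
        \<comment> \<open>For \<open>j = k\<close> the entry vanishes by the choice of
          \<open>y\<close>; for \<open>j < k\<close> the subtracted term has the factor
          \<open>entry b m j = 0\<close>.\<close>
        show "entry b' m j = 0" if "j < Suc k" for j
          using Suc.prems(3) that y by (auto simp: b' less_Suc_eq)
      qed
      then show ?case
        unfolding b'_def by (rule regular_reduce)
    qed
    show ?case
      using **[of a 0] Suc.prems by simp
  qed
  show ?thesis
    unfolding von_neumann_regular_def using *[of _ _ 0] supp_within_exists by blast
qed

section \<open>The monoid \<open>V(R)\<close> through finitary idempotents\<close>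

lift_definition finmat_of :: "'a::zero mat \<Rightarrow> 'a finmat" is
  "\<lambda>A i j. if i < dim_row A \<and> j < dim_col A then A $$ (i, j) else 0"
  by (rule_tac x = "max (dim_row mat) (dim_col mat)" in exI) auto

definition corner :: "nat \<Rightarrow> nat \<Rightarrow> 'a::zero finmat \<Rightarrow> 'a mat" where
  "corner n m a = mat n m (\<lambda>(i, j). entry a i j)"

lemma corner_carrier [simp]: "corner n m a \<in> carrier_mat n m"
  by (simp add: corner_def)

lemma finmat_of_corner:
  assumes "\<And>i j. n \<le> i \<or> m \<le> j \<Longrightarrow> entry a i j = 0"
  shows "finmat_of (corner n m a) = a"
  by (rule finmat_eqI) (use assms in \<open>auto simp: finmat_of.rep_eq corner_def not_less\<close>)

lemma corner_finmat_of: "A \<in> carrier_mat n m \<Longrightarrow> corner n m (finmat_of A) = A"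
  by (rule eq_matI) (auto simp: finmat_of.rep_eq corner_def)

lemma finmat_of_inject:
  "A \<in> carrier_mat n m \<Longrightarrow> B \<in> carrier_mat n m \<Longrightarrow> finmat_of A = finmat_of B \<Longrightarrow> A = B"
  by (metis corner_finmat_of)

lemma finmat_of_mult:
  fixes A B :: "'a::ring mat"
  assumes "dim_col A = dim_row B"
  shows "finmat_of (A * B) = finmat_of A * finmat_of B"
proof (rule finmat_eqI)
  fix i j
  define n where "n = max (dim_row A) (dim_col A)"
  have n: "supp_within n (finmat_of A)"
    by (auto simp: supp_within_def finmat_of.rep_eq n_def)
  have "entry (finmat_of A * finmat_of B) i j = (\<Sum>k<dim_col A. entry (finmat_of A) i k * entry (finmat_of B) k j)"
    unfolding entry_mult[OF n] by (rule sum.mono_neutral_right) (auto simp: n_def finmat_of.rep_eq)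
  also have "\<dots> = entry (finmat_of (A * B)) i j"
    using assms by (auto simp: finmat_of.rep_eq scalar_prod_def atLeast0LessThan intro!: sum.cong)
  finally show "entry (finmat_of (A * B)) i j = entry (finmat_of A * finmat_of B) i j" ..
qed

lemma finmat_of_add:
  fixes A B :: "'a::ring mat"
  assumes "A \<in> carrier_mat n m" "B \<in> carrier_mat n m"
  shows "finmat_of (A + B) = finmat_of A + finmat_of B"
  by (rule finmat_eqI) (use assms in \<open>auto simp: finmat_of.rep_eq plus_finmat.rep_eq\<close>)

lemma finmat_of_idem: "A \<in> idem_mats \<Longrightarrow> finmat_of A * finmat_of A = finmat_of A"
  using finmat_of_mult[of A A] by (auto simp: idem_mats_def)

lemma idem_corner:
  assumes "supp_within n a" "a * a = a"
  shows "corner n n a \<in> idem_mats" "finmat_of (corner n n a) = a"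
proof -
  show *: "finmat_of (corner n n a) = a"
    using assms(1) by (intro finmat_of_corner) (auto simp: supp_within_def)
  have "finmat_of (corner n n a * corner n n a) = finmat_of (corner n n a)"
    by (subst finmat_of_mult) (simp_all add: corner_def[of n n] *[unfolded corner_def] assms)
  then have "corner n n a * corner n n a = corner n n a"
    by (rule finmat_of_inject[OF mult_carrier_mat[OF corner_carrier corner_carrier] corner_carrier])
  then show "corner n n a \<in> idem_mats"
    by (simp add: idem_mats_def corner_def)
qed

text \<open>\<open>u\<close> and \<open>v\<close> may reach beyond the blocks of \<open>A\<close>
  and \<open>B\<close>. Compressing them by the two idempotents confines them to rectangles of the
  right sizes, so cutting out corners loses nothing.\<close>

lemma idem_equiv_if_finmat_of:
  fixes A B :: "'a::ring mat"
  assumes A: "A \<in> idem_mats" and B: "B \<in> idem_mats"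
    and uv: "finmat_of A = u * v" "finmat_of B = v * u"
  shows "(A, B) \<in> idem_equiv"
proof -
  define n m where "n = dim_row A" and "m = dim_row B"
  define u' where "u' = finmat_of A * u * finmat_of B"
  define v' where "v' = finmat_of B * v * finmat_of A"
  have cA: "A \<in> carrier_mat n n" and cB: "B \<in> carrier_mat m m"
    unfolding n_def m_def using A B by (simp_all add: idem_mats_carrier)
  note idem = finmat_of_idem[OF A] finmat_of_idem[OF B]
  have sandwich: "entry (finmat_of C * x * finmat_of D) i j = 0"
    if "dim_row C \<le> i \<or> dim_col D \<le> j" for C D :: "'a mat" and x i j
  proof -
    obtain k where k: "supp_within k (finmat_of C)" "supp_within k (finmat_of C * x)"
      using supp_within_common[of "{finmat_of C, finmat_of C * x}"] by auto
    show ?thesis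
      using that by (auto simp: entry_mult[of k] k finmat_of.rep_eq)
  qed
  have U: "finmat_of (corner n m u') = u'" and V: "finmat_of (corner m n v') = v'"
    using cA cB unfolding u'_def v'_def by (auto intro!: finmat_of_corner sandwich)
  have "u' * v' = finmat_of A * u * (finmat_of B * finmat_of B) * v * finmat_of A"
    unfolding u'_def v'_def by (simp only: mult.assoc)
  also have "\<dots> = finmat_of A * (u * v) * (u * v) * finmat_of A"
    unfolding idem(2) unfolding uv(2) by (simp only: mult.assoc)
  also have "\<dots> = finmat_of A"
    by (simp only: uv(1)[symmetric] idem)
  finally have "finmat_of (corner n m u' * corner m n v') = finmat_of A"
    by (subst finmat_of_mult) (simp_all only: U V, simp add: corner_def)
  then have 1: "corner n m u' * corner m n v' = A"
    by (rule finmat_of_inject[OF mult_carrier_mat[OF corner_carrier corner_carrier] cA])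
  have "v' * u' = finmat_of B * v * (finmat_of A * finmat_of A) * u * finmat_of B"
    unfolding u'_def v'_def by (simp only: mult.assoc)
  also have "\<dots> = finmat_of B * (v * u) * (v * u) * finmat_of B"
    unfolding idem(1) unfolding uv(1) by (simp only: mult.assoc)
  also have "\<dots> = finmat_of B"
    by (simp only: uv(2)[symmetric] idem)
  finally have "finmat_of (corner m n v' * corner n m u') = finmat_of B"
    by (subst finmat_of_mult) (simp_all only: U V, simp add: corner_def)
  then have 2: "corner m n v' * corner n m u' = B"
    by (rule finmat_of_inject[OF mult_carrier_mat[OF corner_carrier corner_carrier] cB])
  show ?thesis
    by (rule idem_equivI[OF A B _ _ 1[symmetric] 2[symmetric]]) (simp_all add: n_def m_def)
qed

text \<open>The least bound is only a canonical choice: for an idempotent every bound gives the same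
  class.\<close>

definition idem_class :: "'a::ring finmat \<Rightarrow> 'a mat set" where
  "idem_class a = (let n = (LEAST n. supp_within n a) in idem_equiv `` {corner n n a})"

lemma idem_class_corner:
  assumes "a * a = a"
  obtains A where "A \<in> idem_mats" "finmat_of A = a" "idem_class a = idem_equiv `` {A}"
proof -
  have "supp_within (LEAST n. supp_within n a) a"
    using supp_within_exists by (rule LeastI_ex)
  from idem_corner[OF this assms] show ?thesis
    by (intro that) (auto simp: idem_class_def Let_def)
qed

lemma idem_class_cong:
  assumes "u * v * (u * v) = u * v" "v * u * (v * u) = v * u"
  shows "idem_class (u * v) = idem_class (v * u)"
proof -
  obtain A where A: "A \<in> idem_mats" "finmat_of A = u * v" "idem_class (u * v) = idem_equiv `` {A}"
    using idem_class_corner[OF assms(1)] .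
  obtain B where B: "B \<in> idem_mats" "finmat_of B = v * u" "idem_class (v * u) = idem_equiv `` {B}"
    using idem_class_corner[OF assms(2)] .
  show ?thesis
    unfolding A(3) B(3)
    by (rule equiv_class_eq[OF equiv_idem_equiv idem_equiv_if_finmat_of[OF A(1) B(1) A(2) B(2)]])
qed

lemma idem_class_finmat_of:
  assumes "A \<in> idem_mats"
  shows "idem_class (finmat_of A) = idem_equiv `` {A}"
proof -
  obtain B where B: "B \<in> idem_mats" "finmat_of B = finmat_of A" "idem_class (finmat_of A) = idem_equiv `` {B}"
    using idem_class_corner[OF finmat_of_idem[OF assms]] .
  have "(B, A) \<in> idem_equiv"
    using idem_equiv_if_finmat_of[OF B(1) assms, of "finmat_of A" "finmat_of A"] B(2) finmat_of_idem[OF assms]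
    by simp
  with B(3) show ?thesis
    by (simp add: equiv_class_eq[OF equiv_idem_equiv])
qed

text \<open>Take \<open>u\<close> to be the block row of \<open>E\<close> and \<open>F\<close>, and
  \<open>v\<close> their block column. Then \<open>u * v = E * E + F * F\<close>, and the
  off-diagonal blocks of \<open>v * u\<close> are \<open>E * F\<close> and \<open>F * E\<close>,
  which vanish.\<close>

lemma diag_sum_orthogonal:
  fixes E F :: "'a::ring mat"
  assumes "E \<in> carrier_mat n n" "F \<in> carrier_mat n n"
    "E * E = E" "F * F = F" "E * F = 0\<^sub>m n n" "F * E = 0\<^sub>m n n"
  shows "E + F \<in> idem_mats" "(E + F, diag_sum E F) \<in> idem_equiv"
proof -
  have "(E + F) * (E + F) = E + F"
    using assms by (simp add: add_mult_distrib_mat[of _ n n] mult_add_distrib_mat[of _ n n])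
  with assms show EF: "E + F \<in> idem_mats"
    by (auto simp: idem_mats_def)
  have idem: "E \<in> idem_mats" "F \<in> idem_mats"
    using assms by (auto simp: idem_mats_def)
  define u where "u = four_block_mat E F (0\<^sub>m 0 n) (0\<^sub>m 0 n)"
  define v where "v = four_block_mat E (0\<^sub>m n 0) F (0\<^sub>m n 0)"
  have "u * v = four_block_mat (E * E + F * F) (0\<^sub>m n 0) (0\<^sub>m 0 n) (0\<^sub>m 0 0)"
    unfolding u_def v_def using assms(1,2)
    by (subst mult_four_block_mat[of _ n n _ n _ 0 _ _ n _ 0]) auto
  also have "\<dots> = E + F"
    using assms by (intro eq_matI) auto
  finally have 1: "u * v = E + F" .
  have 2: "v * u = diag_sum E F"
    unfolding u_def v_def diag_sum_def using assms
    by (subst mult_four_block_mat[of _ n n _ 0 _ n _ _ n _ n]) auto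
  show "(E + F, diag_sum E F) \<in> idem_equiv"
    by (rule idem_equivI[OF EF diag_sum_idem[OF idem] _ _ 1[symmetric] 2[symmetric]])
       (use assms(1,2) in \<open>auto simp: u_def v_def diag_sum_def\<close>)
qed

text \<open>A common bound on the supports represents both idempotents by matrices of one size,
  where the orthogonal sum is equivalent to the diagonal sum.\<close>

lemma idem_class_add:
  assumes "e * e = e" "f * f = f" "e * f = 0" "f * e = 0"
  shows "idem_class (e + f) = mult V_monoid (idem_class e) (idem_class f)"
proof -
  obtain n where n: "supp_within n e" "supp_within n f"
    using supp_within_common[of "{e, f}"] by auto
  define E F where "E = corner n n e" and "F = corner n n f"
  have c: "E \<in> carrier_mat n n" "F \<in> carrier_mat n n"
    by (simp_all add: E_def F_def)
  have E: "E \<in> idem_mats" "finmat_of E = e" and F: "F \<in> idem_mats" "finmat_of F = f"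
    unfolding E_def F_def using idem_corner n assms by auto
  have 0: "finmat_of (0\<^sub>m n n :: 'a mat) = 0"
    by (rule finmat_eqI) (simp add: finmat_of.rep_eq zero_finmat.rep_eq)
  have "E * F = 0\<^sub>m n n" "F * E = 0\<^sub>m n n"
    using c by (auto intro!: finmat_of_inject[of _ n n] simp: finmat_of_mult E F 0 assms)
  from diag_sum_orthogonal[OF c idem_mats_idem[OF E(1)] idem_mats_idem[OF F(1)] this]
  have "idem_class (finmat_of (E + F)) = idem_equiv `` {diag_sum E F}"
    by (simp add: idem_class_finmat_of equiv_class_eq[OF equiv_idem_equiv])
  moreover have "idem_class e = idem_equiv `` {E}" "idem_class f = idem_equiv `` {F}"
    using idem_class_finmat_of E F by metis+
  ultimately show ?thesis
    by (simp add: V_mult E F finmat_of_add[OF c])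
qed

lemma idem_class_carrier:
  assumes "a * a = a"
  shows "idem_class a \<in> carrier V_monoid"
proof -
  obtain A where "A \<in> idem_mats" "idem_class a = idem_equiv `` {A}"
    using idem_class_corner[OF assms] .
  then show ?thesis
    by (simp add: V_monoid_def quotientI)
qed

text \<open>A matrix equivalent to the empty one factors through size 0, so its entries are empty
  sums.\<close>

lemma idem_class_eq_one:
  assumes "a * a = a" "idem_class a = one V_monoid"
  shows "a = 0"
proof -
  obtain A where A: "A \<in> idem_mats" "finmat_of A = a" "idem_class a = idem_equiv `` {A}"
    using idem_class_corner[OF assms(1)] .
  have Z: "(0\<^sub>m 0 0 :: 'a mat) \<in> idem_mats"
    by (auto simp: idem_mats_def)
  have "idem_equiv `` {A} = idem_equiv `` {0\<^sub>m 0 0}"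
    using assms(2) A(3) by (simp add: V_monoid_def)
  then have "(A, 0\<^sub>m 0 0) \<in> idem_equiv"
    by (rule eq_equiv_class[OF _ equiv_idem_equiv Z])
  then obtain u v where "u \<in> carrier_mat (dim_row A) (dim_row (0\<^sub>m 0 0 :: 'a mat))"
      "v \<in> carrier_mat (dim_row (0\<^sub>m 0 0 :: 'a mat)) (dim_row A)" "A = u * v"
    by (rule idem_equivE) blast
  note uv = this[unfolded index_zero_mat]
  have "finmat_of (u * v) = 0"
    using carrier_matD[OF uv(1)] carrier_matD[OF uv(2)]
    by (intro finmat_eqI) (simp add: finmat_of.rep_eq zero_finmat.rep_eq scalar_prod_def)
  then show ?thesis
    by (simp only: A(2) uv(3)[symmetric])
qed

text \<open>Shifting \<open>B\<close> past the block of \<open>A\<close> makes the two idempotents orthogonal.\<close>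

lemma idem_class_sum_decompose:
  assumes A: "A \<in> idem_mats" and B: "B \<in> idem_mats"
  obtains p q where "p * p = p" "q * q = q" "p * q = 0" "q * p = 0"
    "p + q = finmat_of (diag_sum A B)" "idem_class p = idem_equiv `` {A}" "idem_class q = idem_equiv `` {B}"
proof -
  define n m where "n = dim_row A" and "m = dim_row B"
  have c: "A \<in> carrier_mat n n" "B \<in> carrier_mat m m"
    unfolding n_def m_def using A B by (simp_all add: idem_mats_carrier)
  define P Q where "P = diag_sum A (0\<^sub>m m m)" and "Q = diag_sum (0\<^sub>m n n) B"
  have Z: "(0\<^sub>m k k :: 'a mat) \<in> idem_mats" for k
    by (auto simp: idem_mats_def)
  have PQ: "P \<in> idem_mats" "Q \<in> idem_mats"
    unfolding P_def Q_def using A B Z by (auto intro: diag_sum_idem)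
  have cPQ: "P \<in> carrier_mat (n + m) (n + m)" "Q \<in> carrier_mat (n + m) (n + m)"
    using c by (auto simp: P_def Q_def diag_sum_def)
  have 0: "finmat_of (0\<^sub>m k l :: 'a mat) = 0" for k l
    by (rule finmat_eqI) (simp add: finmat_of.rep_eq zero_finmat.rep_eq)
  have orth: "P * Q = 0\<^sub>m (n + m) (n + m)" "Q * P = 0\<^sub>m (n + m) (n + m)"
    unfolding P_def Q_def diag_sum_def using c
    by (auto simp: mult_diag_blocks[of _ n n _ m m _ n _ m] intro!: eq_matI)
  have "P + Q = diag_sum A B"
    using c by (intro eq_matI) (auto simp: P_def Q_def diag_sum_def)
  then have sum: "finmat_of P + finmat_of Q = finmat_of (diag_sum A B)"
    by (simp add: finmat_of_add[OF cPQ, symmetric])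
  \<comment> \<open>Zero matrices of all sizes become the same finitary matrix.\<close>
  have Z0: "idem_equiv `` {0\<^sub>m k k} = one (V_monoid :: 'a mat set monoid)" for k
  proof -
    have "idem_equiv `` {0\<^sub>m k k :: 'a mat} = idem_class (finmat_of (0\<^sub>m 0 0))"
      using idem_class_finmat_of[OF Z[of k]] by (simp add: 0)
    then show ?thesis
      by (simp add: idem_class_finmat_of[OF Z] V_monoid_def)
  qed
  interpret V: comm_monoid "V_monoid :: 'a mat set monoid"
    by (rule comm_monoid_V)
  have car: "idem_equiv `` {A} \<in> carrier V_monoid" "idem_equiv `` {B} \<in> carrier V_monoid"
    using A B by (auto simp: V_monoid_def quotientI)
  have "idem_class (finmat_of P) = idem_equiv `` {A}" "idem_class (finmat_of Q) = idem_equiv `` {B}"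
    unfolding idem_class_finmat_of[OF PQ(1)] idem_class_finmat_of[OF PQ(2)]
    unfolding P_def Q_def V_mult[OF A Z, symmetric] V_mult[OF Z B, symmetric] Z0
    using car by simp_all
  moreover have "finmat_of P * finmat_of Q = 0" "finmat_of Q * finmat_of P = 0"
    using cPQ orth by (simp_all add: finmat_of_mult[symmetric] 0)
  ultimately show ?thesis
    using PQ sum by (intro that) (auto simp: finmat_of_idem)
qed

lemma idem_class_eqD:
  assumes "a * a = a" "b * b = b" "idem_class a = idem_class b"
  obtains u v where "a = u * v" "b = v * u"
proof -
  obtain A where A: "A \<in> idem_mats" "finmat_of A = a" "idem_class a = idem_equiv `` {A}"
    using idem_class_corner[OF assms(1)] .
  obtain B where B: "B \<in> idem_mats" "finmat_of B = b" "idem_class b = idem_equiv `` {B}"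
    using idem_class_corner[OF assms(2)] .
  have "(A, B) \<in> idem_equiv"
    using assms(3) unfolding A(3) B(3) by (rule eq_equiv_class[OF _ equiv_idem_equiv B(1)])
  then obtain u v where uv: "u \<in> carrier_mat (dim_row A) (dim_row B)"
      "v \<in> carrier_mat (dim_row B) (dim_row A)" "A = u * v" "B = v * u"
    by (rule idem_equivE) blast
  have "finmat_of (u * v) = finmat_of u * finmat_of v" "finmat_of (v * u) = finmat_of v * finmat_of u"
    using carrier_matD[OF uv(1)] carrier_matD[OF uv(2)] by (simp_all add: finmat_of_mult)
  then show ?thesis
    by (intro that[of "finmat_of u" "finmat_of v"]) (simp_all only: A(2)[symmetric] B(2)[symmetric] uv(3,4)[symmetric])
qed

text \<open>Sending \<open>x\<close> to \<open>u * x * v\<close> carries the decomposition over: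
  \<open>(u * p) * (p * v)\<close> is equivalent to \<open>(p * v) * (u * p) = p\<close>, because
  \<open>v * u\<close> fixes \<open>p\<close>; likewise for \<open>q\<close>.\<close>

lemma transport_decomposition:
  fixes p :: "'a::ring finmat"
  assumes p: "p * p = p" and q: "q * q = q" "p * q = 0" "q * p = 0"
    and sum: "p + q = v * u" and e: "u * v * (u * v) = u * v"
  obtains p' q' where "p' * p' = p'" "q' * q' = q'" "p' * q' = 0" "q' * p' = 0"
    "p' + q' = u * v" "idem_class p' = idem_class p" "idem_class q' = idem_class q"
proof -
  have vu: "v * u * p = p" "v * u * q = q"
    unfolding sum[symmetric] by (simp_all add: distrib_right p q)
  have vu': "v * (u * (p * x)) = p * x" "v * (u * (q * x)) = q * x" for x
    using vu by (simp_all add: mult.assoc[symmetric])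
  have pq: "p * (p * x) = p * x" "q * (q * x) = q * x" "p * (q * x) = 0" "q * (p * x) = 0" for x
    using p q by (simp_all add: mult.assoc[symmetric])
  have "idem_class (u * p * v) = idem_class p" "idem_class (u * q * v) = idem_class q"
    using idem_class_cong[of "u * p" "p * v"] idem_class_cong[of "u * q" "q * v"]
    by (simp_all add: mult.assoc vu' pq vu[unfolded mult.assoc] p q)
  moreover have "u * p * v + u * q * v = u * v"
  proof -
    have "u * p * v + u * q * v = u * (p + q) * v"
      by (simp add: distrib_left distrib_right)
    also have "\<dots> = u * v * (u * v)"
      unfolding sum by (simp only: mult.assoc)
    finally show ?thesis
      using e by simp
  qed
  ultimately show ?thesis
    by (intro that[of "u * p * v" "u * q * v"]) (simp_all add: mult.assoc vu' pq)
qed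

section \<open>Weights on presented monoids\<close>

definition weight :: "('g \<Rightarrow> 'm::comm_monoid_add) \<Rightarrow> 'g multiset set \<Rightarrow> 'm" where
  "weight g P = (\<Sum>x\<in>#(SOME u. u \<in> P). g x)"

lemma weight_class:
  assumes "\<And>u v. (u, v) \<in> Rels \<Longrightarrow> (\<Sum>x\<in>#u. g x) = (\<Sum>x\<in>#v. g x)"
  shows "weight g (comm_cong Rels `` {u}) = (\<Sum>x\<in>#u. g x)"
proof -
  have cong: "(\<Sum>x\<in>#u. g x) = (\<Sum>x\<in>#v. g x)" if "(u, v) \<in> comm_cong Rels" for u v
    using that by induction (auto dest: assms)
  have "u \<in> comm_cong Rels `` {u}"
    by (simp add: comm_cong.refl)
  then have "(SOME v. v \<in> comm_cong Rels `` {u}) \<in> comm_cong Rels `` {u}"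
    by (rule someI)
  then show ?thesis
    unfolding weight_def by (intro cong[symmetric]) simp
qed

text \<open>Orthogonal sums become sums in V(R), which \<open>h\<close> and then the weight turn
  into sums of values.\<close>

lemma dim_fun_weight:
  fixes h :: "'r::ring mat set \<Rightarrow> 'g multiset set"
  assumes h: "h \<in> hom V_monoid (presented_monoid Rels)"
    and g: "\<And>u v. (u, v) \<in> Rels \<Longrightarrow> (\<Sum>x\<in>#u. g x) = (\<Sum>x\<in>#v. g x)"
  shows "dim_fun (\<lambda>a. weight g (h (idem_class a)))"
proof
  fix e f :: "'r finmat"
  assume ef: "e * e = e" "f * f = f" "e * f = 0" "f * e = 0"
  have "h (idem_class e) \<in> carrier (presented_monoid Rels)"
    "h (idem_class f) \<in> carrier (presented_monoid Rels)"
    using hom_in_carrier[OF h] ef by (simp_all add: idem_class_carrier)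
  then obtain u v where uv: "h (idem_class e) = comm_cong Rels `` {u}"
      "h (idem_class f) = comm_cong Rels `` {v}"
    by (auto simp: presented_monoid_def quotient_def)
  have "h (idem_class (e + f)) = comm_cong Rels `` {u + v}"
    unfolding idem_class_add[OF ef] using ef
    by (simp add: hom_mult[OF h] idem_class_carrier uv presented_mult)
  then show "weight g (h (idem_class (e + f)))
      = weight g (h (idem_class e)) + weight g (h (idem_class f))"
    by (simp add: uv weight_class[OF g])
qed (simp add: idem_class_cong)

text \<open>
  \<open>rank_weight i\<close> counts copies of the generator \<open>GA i\<close>: it is \<open>1\<close> on \<open>y\<^sub>l\<close> and \<open>z\<^sub>l\<close> for
  \<open>l \<le> i\<close>, and \<open>x\<^sub>l\<close> contains \<open>y\<^sub>l\<^sub>+\<^sub>1, y\<^sub>l\<^sub>+\<^sub>2, \<dots>\<close>.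
\<close>

fun rank_weight :: "nat \<Rightarrow> gen \<Rightarrow> nat" where
  "rank_weight i (GX l) = i - l"
| "rank_weight i (GY l) = of_bool (l \<le> i)"
| "rank_weight i (GZ l) = of_bool (l \<le> i)"
| "rank_weight i (GA l) = of_bool (l = i)"

text \<open>Shows that y_0 is not below z_0. Infinity on the \<open>GX\<close> generators absorbs
  the difference between \<open>GY\<close> and \<open>GZ\<close> wherever a relation compares
  them.\<close>

fun xy_weight :: "gen \<Rightarrow> enat" where
  "xy_weight (GX l) = \<infinity>"
| "xy_weight (GY l) = \<infinity>"
| "xy_weight (GZ l) = 0"
| "xy_weight (GA l) = 0"

lemma rank_weight_rels: "(u, v) \<in> M_rels \<Longrightarrow> (\<Sum>x\<in>#u. rank_weight i x) = (\<Sum>x\<in>#v. rank_weight i x)"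
  by (auto simp: M_rels_def of_bool_def)

lemma xy_weight_rels: "(u, v) \<in> M_rels \<Longrightarrow> (\<Sum>x\<in>#u. xy_weight x) = (\<Sum>x\<in>#v. xy_weight x)"
  by (auto simp: M_rels_def)

text \<open>Each generator is detected by some rank: \<open>GX l\<close> by
  \<open>i = l + 1\<close>, as the truncated difference \<open>i - l\<close> is 0 up to
  \<open>i = l\<close>, and the others by \<open>i = l\<close>.\<close>

lemma rank_weight_faithful:
  assumes "\<And>i. (\<Sum>x\<in>#u. rank_weight i x) = 0"
  shows "u = {#}"
proof (rule ccontr)
  assume "u \<noteq> {#}"
  then obtain x where x: "x \<in># u"
    by blast
  have "\<exists>i. rank_weight i x \<noteq> 0"
  proof (cases x)
    case (GX l)
    then show ?thesis
      by (intro exI[of _ "Suc l"]) simp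
  qed auto
  then obtain i where "rank_weight i x \<noteq> 0" ..
  with assms[of i] x show False
    by (auto simp: sum_mset_0_iff)
qed

section \<open>Two decompositions of one idempotent, and the contradiction\<close>

theorem proposition4p6:
  fixes scale :: "'k::field \<Rightarrow> 'r::ring \<Rightarrow> 'r"
  assumes "uncountable (UNIV :: 'k set)"
    and "algebra_over scale"
    and "von_neumann_regular TYPE('r)"
  shows "\<not> (V_monoid :: 'r mat set monoid) \<cong> M_monoid"
proof
  assume "(V_monoid :: 'r mat set monoid) \<cong> M_monoid"
  then obtain h :: "'r mat set \<Rightarrow> gen multiset set" where "h \<in> iso V_monoid M_monoid"
    unfolding is_iso_def by blast
  then have hom: "h \<in> hom V_monoid M_monoid" and bij: "bij_betw h (carrier V_monoid) (carrier M_monoid)"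
    by (auto simp: iso_def)
  interpret V: comm_monoid "V_monoid :: 'r mat set monoid"
    by (rule comm_monoid_V)
  interpret M: comm_monoid M_monoid
    unfolding M_monoid_def by (rule comm_monoid_presented)
  let ?cl = "\<lambda>u. comm_cong M_rels `` {u}"
  have car: "P \<in> carrier M_monoid \<longleftrightarrow> (\<exists>u. P = ?cl u)" for P
    by (auto simp: M_monoid_def presented_monoid_def quotient_def)
  \<comment> \<open>Membership in \<open>iso\<close> does not mention neutral elements. Surjectivity
    helps: a preimage \<open>x\<close> of the neutral element shows that \<open>h\<close> of the
    neutral element equals \<open>h x\<close>.\<close>
  have one: "h \<one>\<^bsub>V_monoid\<^esub> = \<one>\<^bsub>M_monoid\<^esub>"
  proof -
    obtain x where x: "x \<in> carrier V_monoid" "h x = \<one>\<^bsub>M_monoid\<^esub>"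
      using bij M.one_closed unfolding bij_betw_def by (metis imageE)
    have "h (\<one>\<^bsub>V_monoid\<^esub> \<otimes>\<^bsub>V_monoid\<^esub> x) = h \<one>\<^bsub>V_monoid\<^esub> \<otimes>\<^bsub>M_monoid\<^esub> h x"
      using x(1) by (intro hom_mult[OF hom]) auto
    then show ?thesis
      using x hom_in_carrier[OF hom V.one_closed] by simp
  qed
  have "\<exists>A\<in>idem_mats. h (idem_equiv `` {A}) = ?cl u" for u
  proof -
    have "?cl u \<in> h ` carrier V_monoid"
      using bij car unfolding bij_betw_def by blast
    then show ?thesis
      by (auto simp: V_monoid_def quotient_def)
  qed
  then obtain mat_of where mat: "\<And>u. mat_of u \<in> idem_mats"
      "\<And>u. h (idem_equiv `` {mat_of u}) = ?cl u"
    by metis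
  define A B C where "A = mat_of {#GX 0#}" and "B = mat_of {#GY 0#}" and "C = mat_of {#GZ 0#}"
  have ABC: "A \<in> idem_mats" "B \<in> idem_mats" "C \<in> idem_mats"
    unfolding A_def B_def C_def by (rule mat)+
  have classes: "idem_equiv `` {D} \<in> carrier V_monoid" if "D \<in> idem_mats" for D :: "'r mat"
    using that by (simp add: V_monoid_def quotientI)
  have h_sum: "h (idem_equiv `` {diag_sum (mat_of u) (mat_of v)}) = ?cl (u + v)" for u v
  proof -
    have "h (idem_equiv `` {diag_sum (mat_of u) (mat_of v)}) = ?cl u \<otimes>\<^bsub>M_monoid\<^esub> ?cl v"
      by (simp only: V_mult[OF mat(1) mat(1), symmetric] hom_mult[OF hom classes[OF mat(1)] classes[OF mat(1)]] mat(2))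
    then show ?thesis
      by (simp add: M_monoid_def presented_mult)
  qed
  \<comment> \<open>The first defining relation and injectivity of \<open>h\<close> make the two
    diagonal sums equivalent.\<close>
  have "({#GX 0#} + {#GY 0#}, {#GX 0#} + {#GZ 0#}) \<in> comm_cong M_rels"
    by (rule comm_cong.base) (simp add: M_rels_def)
  then have "h (idem_equiv `` {diag_sum A B}) = h (idem_equiv `` {diag_sum A C})"
    unfolding A_def B_def C_def h_sum by (rule equiv_class_eq[OF equiv_comm_cong])
  then have "idem_class (finmat_of (diag_sum A B)) = idem_class (finmat_of (diag_sum A C))"
    using inj_onD[OF bij_betw_imp_inj_on[OF bij]] ABC
    by (simp add: idem_class_finmat_of diag_sum_idem classes)
  then obtain u v where uv: "finmat_of (diag_sum A B) = u * v" "finmat_of (diag_sum A C) = v * u"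
    by (rule idem_class_eqD[rotated 2]) (simp_all add: finmat_of_idem diag_sum_idem ABC)
  obtain p q where p: "p * p = p" and q: "q * q = q" "p * q = 0" "q * p = 0"
    and pq: "p + q = u * v" and cls: "idem_class p = idem_equiv `` {A}" "idem_class q = idem_equiv `` {B}"
    using idem_class_sum_decompose[OF ABC(1,2)] unfolding uv(1) .
  obtain p'' r'' where pr: "p'' * p'' = p''" "r'' * r'' = r''" "p'' * r'' = 0" "r'' * p'' = 0"
    "p'' + r'' = v * u" and cls'': "idem_class p'' = idem_equiv `` {A}" "idem_class r'' = idem_equiv `` {C}"
    using idem_class_sum_decompose[OF ABC(1,3)] unfolding uv(2) .
  have uvuv: "u * v * (u * v) = u * v"
    using finmat_of_idem[OF diag_sum_idem[OF ABC(1,2)]] unfolding uv(1) .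
  \<comment> \<open>The second decomposition, found under \<open>v * u\<close>, is moved under
    \<open>u * v\<close>, so that both decompose the same idempotent.\<close>
  obtain p' r where p': "p' * p' = p'" and r: "r * r = r" "p' * r = 0" "r * p' = 0"
    and sum: "p' + r = u * v" and cls': "idem_class p' = idem_class p''" "idem_class r = idem_class r''"
    by (rule transport_decomposition[OF pr uvuv])
  obtain s s' where s: "p = s * s'" "p' = s' * s"
    using idem_class_eqD[OF p p'] cls cls' cls'' by metis
  define d where "d i a = weight (rank_weight i) (h (idem_class a))" for i and a :: "'r finmat"
  have dim: "dim_fun (d i)" for i
    unfolding d_def by (rule dim_fun_weight[OF hom[unfolded M_monoid_def] rank_weight_rels])
  have faithful: "a = 0" if "a * a = a" "\<And>i. d i a = 0" for a
  proof (rule idem_class_eq_one[OF that(1)])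
    have c: "idem_class a \<in> carrier V_monoid"
      using that(1) by (rule idem_class_carrier)
    then obtain w where w: "h (idem_class a) = ?cl w"
      using hom_in_carrier[OF hom] car by blast
    have "w = {#}"
      using that(2) by (intro rank_weight_faithful) (simp add: d_def w weight_class[OF rank_weight_rels])
    then have "h (idem_class a) = h \<one>\<^bsub>V_monoid\<^esub>"
      by (simp add: w one) (simp add: M_monoid_def presented_monoid_def)
    then show "idem_class a = \<one>\<^bsub>V_monoid\<^esub>"
      using inj_onD[OF bij_betw_imp_inj_on[OF bij]] c by simp
  qed
  obtain a b where ab: "q = a * b" "r * b = b" "a * r = a" "b * q = b"
    by (rule algebra_over.complement_subequivalent[OF algebra_over_finmat[OF assms(2)] dim
          von_neumann_regular_finmat[OF assms(3)] faithful assms(1) p q p' r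
          pq[folded sum] s(1)[symmetric] s(2)[symmetric]])
  interpret xy: dim_fun "\<lambda>a. weight xy_weight (h (idem_class a))"
    by (rule dim_fun_weight[OF hom[unfolded M_monoid_def] xy_weight_rels])
  \<comment> \<open>\<open>b * a\<close> is an idempotent below \<open>r\<close> and equivalent to
    \<open>q = a * b\<close>. So the weight of \<open>q\<close>, which is infinite, is at most that
    of \<open>r\<close>, which is 0.\<close>
  have ba: "b * a * (b * a) = b * a"
    using ab(1,4) by (metis mult.assoc)
  have "weight xy_weight (h (idem_class q)) = weight xy_weight (h (idem_class (b * a)))"
    using xy.dim_cong[of a b] ba q(1) ab(1) by simp
  also have "\<dots> \<le> weight xy_weight (h (idem_class r))"
  proof -
    have "r * (b * a) = b * a" "b * a * r = b * a"
      using ab by (simp_all add: mult.assoc) (simp add: mult.assoc[symmetric])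
    from xy.dim_sub[OF r(1) ba this] show ?thesis
      by simp
  qed
  also have "\<dots> = 0"
    by (simp add: cls' cls'' C_def mat(2) weight_class[OF xy_weight_rels])
  finally show False
    by (simp add: cls B_def mat(2) weight_class[OF xy_weight_rels])
qed

end
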